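(* Let $(\{x_\alpha\}_{\alpha\in\Omega},\{\tau_\alpha\}_{\alpha\in\Omega})$ be a continuous frame for a finite dimensional complex Hilbert space $\mathcal{H}$ of dimension $m$, with frame operator $S_{x,\tau}$. Then: (i) The optimal lower frame bound (resp. optimal upper frame bound) is the smallest (resp. largest) eigenvalue of $S_{x,\tau}$. (ii) If $\{\lambda_j\}_{j=1}^m$ denotes the eigenvalues of $S_{x,\tau}$, each appearing as many times as its algebraic multiplicity, then $$\sum_{j=1}^m\lambda_j=\int_\Omega\langle x_\alpha,\tau_\alpha\rangle\,d\mu(\alpha)=\int_\Omega\langle\tau_\alpha,x_\alpha\rangle\,d\mu(\alpha).$$ (iii) The condition number of $S_{x,\tau}$ equals the ratio between the optimal upper frame bound and the optimal lower frame bound. (iv) If the optimal upper frame bound is $b$, then $$b\le\int_\Omega\langle x_\alpha,\tau_\alpha\rangle\,d\mu(\alpha)=\int_\Omega\langle\tau_\alpha,x_\alpha\rangle\,d\mu(\alpha)\le mb.$$ (v) $$\operatorname{Trace}(S_{x,\tau})=\int_\Omega\langle x_\alpha,\tau_\alpha\rangle\,d\mu(\alpha)=\int_\Omega\langle\tau_\alpha,x_\alpha\rangle\,d\mu(\alpha),$$ $$\operatorname{Trace}(S_{x,\tau}^2)=\int_\Omega\int_\Omega\langle\tau_\alpha,x_\beta\rangle\langle\tau_\beta,x_\alpha\rangle\,d\mu(\beta)\,d\mu(\alpha)=\int_\Omega\int_\Omega\langle\tau_\alpha,\tau_\beta\rangle\langle x_\beta,x_\alpha\rangle\,d\mu(\beta)\,d\mu(\alpha).$$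 (vi) If the frame is tight, then the optimal frame bound is $b=\frac1m\int_\Omega\langle x_\alpha,\tau_\alpha\rangle\,d\mu(\alpha)=\frac1m\int_\Omega\langle\tau_\alpha,x_\alpha\rangle\,d\mu(\alpha)$. In particular, if $\langle x_\alpha,\tau_\alpha\rangle=1$ for all $\alpha\in\Omega$, then $b=\mu(\Omega)/m$. Further, for all $h\in\mathcal{H}$, $$h=\frac1b\int_\Omega\langle h,x_\alpha\rangle\tau_\alpha\,d\mu(\alpha)=\frac1b\int_\Omega\langle h,\tau_\alpha\rangle x_\alpha\,d\mu(\alpha),$$ $$\|h\|^2=\frac1b\int_\Omega\langle h,x_\alpha\rangle\langle\tau_\alpha,h\rangle\,d\mu(\alpha)=\frac1b\int_\Omega\langle h,\tau_\alpha\rangle\langle x_\alpha,h\rangle\,d\mu(\alpha).$$ (vii) (Extended variation formula) If the frame is tight, then $$\int_\Omega\int_\Omega\langle\tau_\alpha,x_\beta\rangle\langle\tau_\beta,x_\alpha\rangle\,d\mu(\beta)\,d\mu(\alpha)=\frac{1}{\dim\mathcal{H}}\left(\int_\Omega\langle x_\alpha,\tau_\alpha\rangle\,d\mu(\alpha)\right)^2$$ $$=\frac{1}{\dim\mathcal{H}}\left(\int_\Omega\langle\tau_\alpha,x_\alpha\rangle\,d\mu(\alpha)\right)^2=\int_\Omega\int_\Omega\langle\tau_\alpha,\tau_\beta\rangle\langle x_\beta,x_\alpha\rangle\,d\mu(\beta)\,d\mu(\alpha).$$ (viii) (Extended dimension formula) If the frame is Parseval, then $\dim\mathcal{H}=\int_\Omega\langle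 x_\alpha,\tau_\alpha\rangle\,d\mu(\alpha)=\int_\Omega\langle\tau_\alpha,x_\alpha\rangle\,d\mu(\alpha)$. (ix) (Extended trace formula) If the frame is Parseval, then for every $T\in\mathcal{B}(\mathcal{H})$, $\operatorname{Trace}(T)=\int_\Omega\langle Tx_\alpha,\tau_\alpha\rangle\,d\mu(\alpha)=\int_\Omega\langle T\tau_\alpha,x_\alpha\rangle\,d\mu(\alpha)$.
   Context: $(\Omega,\mu)$ is a measure space with positive measure, and $\mathbb{K}$ is the scalar field (here $\mathbb{C}$). All vector-valued integrals are weak: $\int_\Omega F\,d\mu$ is the element of $\mathcal{H}$ with $\langle\int_\Omega F\,d\mu,g\rangle=\int_\Omega\langle F(\alpha),g\rangle\,d\mu(\alpha)$ for all $g\in\mathcal{H}$. A family $\{x_\alpha\}_{\alpha\in\Omega}$ in $\mathcal{H}$ is a continuous frame with respect to a family $\{\tau_\alpha\}_{\alpha\in\Omega}$ in $\mathcal{H}$ (one says $(\{x_\alpha\}_{\alpha\in\Omega},\{\tau_\alpha\}_{\alpha\in\Omega})$ is a continuous frame for $\mathcal{H}$) if: (i) for each $h\in\mathcal{H}$ the maps $\alpha\mapsto\langle h,x_\alpha\rangle$ and $\alpha\mapsto\langle h,\tau_\alpha\rangle$ are measurable; (ii) the frame operator $S_{x,\tau}:\mathcal{H}\ni h\mapsto\int_\Omega\langle h,x_\alpha\rangle\tau_\alpha\,d\mu(\alpha)\in\mathcal{H}$ is a well-defined bounded positive invertible operator; (iii) the analysis operators $\theta_x,\theta_\tau:\mathcal{H}\to\mathcal{L}^2(\Omega,\mathbb{K})$,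 $(\theta_xh)(\alpha)=\langle h,x_\alpha\rangle$, $(\theta_\tau h)(\alpha)=\langle h,\tau_\alpha\rangle$, are well-defined bounded linear operators. Real numbers $a,b>0$ are (lower and upper) frame bounds if $a\|h\|^2\le\langle S_{x,\tau}h,h\rangle\le b\|h\|^2$ for all $h$; the optimal lower (upper) frame bound is the largest such $a$ (smallest such $b$). The frame is tight if $S_{x,\tau}=bI_{\mathcal{H}}$ for some $b>0$ (its optimal frame bound), and Parseval if $S_{x,\tau}=I_{\mathcal{H}}$. The condition number of an invertible operator $S$ is $\|S\|\|S^{-1}\|$ (operator norm). *)

theory Defs
  imports
    "HOL-Analysis.Analysis"
    "HOL-Library.Complex_Order"
    "HOL-Computational_Algebra.Fundamental_Theorem_Algebra"
    "Jordan_Normal_Form.Char_Poly"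
begin

text \<open>
  On the complex numbers, \<open>z \<le> w\<close> means \<open>Re z \<le> Re w\<close> and \<open>Im z = Im w\<close>
  (from \<open>HOL-Library.Complex_Order\<close>). In particular, a complex number that is
  comparable with a real one is itself real.
\<close>

section \<open>Complex Hilbert spaces\<close>

text \<open>The inner product is linear in the first argument and antilinear in the second.\<close>

class complex_inner = real_normed_vector +
  fixes scaleC :: "complex \<Rightarrow> 'a \<Rightarrow> 'a" (infixr "*\<^sub>C" 75)
    and cinner :: "'a \<Rightarrow> 'a \<Rightarrow> complex" ("\<langle>_, _\<rangle>")
  assumes scaleC_add_right: "a *\<^sub>C (x + y) = a *\<^sub>C x + a *\<^sub>C y"
    and scaleC_add_left: "(a + b) *\<^sub>C x = a *\<^sub>C x + b *\<^sub>C x"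
    and scaleC_scaleC: "a *\<^sub>C (b *\<^sub>C x) = (a * b) *\<^sub>C x"
    and scaleC_one: "1 *\<^sub>C x = x"
    and scaleR_scaleC: "r *\<^sub>R x = of_real r *\<^sub>C x"
    and cinner_commute: "\<langle>x, y\<rangle> = cnj \<langle>y, x\<rangle>"
    and cinner_add_left: "\<langle>x + y, z\<rangle> = \<langle>x, z\<rangle> + \<langle>y, z\<rangle>"
    and cinner_scaleC_left: "\<langle>a *\<^sub>C x, y\<rangle> = a * \<langle>x, y\<rangle>"
    and cinner_ge_zero: "0 \<le> \<langle>x, x\<rangle>"
    and cinner_eq_zero_iff: "\<langle>x, x\<rangle> = 0 \<longleftrightarrow> x = 0"
    and norm_eq_sqrt_cinner: "norm x = sqrt (Re \<langle>x, x\<rangle>)"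

class chilbert_space = complex_inner + complete_space

interpretation complex_vector: vector_space "scaleC :: complex \<Rightarrow> 'h \<Rightarrow> 'h::complex_inner"
  by standard (simp_all add: scaleC_add_right scaleC_add_left scaleC_scaleC scaleC_one)

section \<open>Operators\<close>

abbreviation clinear :: "('h::complex_inner \<Rightarrow> 'h) \<Rightarrow> bool" where
  "clinear \<equiv> Vector_Spaces.linear scaleC scaleC"

text \<open>Since every element of \<open>\<B>(\<H>)\<close> is real-linear, \<^const>\<open>onorm\<close> is its operator norm.\<close>

definition bounded_clinear :: "('h::complex_inner \<Rightarrow> 'h) \<Rightarrow> bool" where
  "bounded_clinear T \<longleftrightarrow> clinear T \<and> (\<exists>K. \<forall>h. norm (T h) \<le> K * norm h)"

definition positive_op :: "('h::complex_inner \<Rightarrow> 'h) \<Rightarrow> bool" where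
  "positive_op T \<longleftrightarrow> (\<forall>h. 0 \<le> \<langle>T h, h\<rangle>)"

definition invertible_op :: "('h::complex_inner \<Rightarrow> 'h) \<Rightarrow> bool" where
  "invertible_op T \<longleftrightarrow> (\<exists>R. bounded_clinear R \<and> R \<circ> T = id \<and> T \<circ> R = id)"

definition condition_number :: "('h::complex_inner \<Rightarrow> 'h) \<Rightarrow> real" where
  "condition_number T = onorm T * onorm (inv_into UNIV T)"

definition op_eigenvalue :: "('h::complex_inner \<Rightarrow> 'h) \<Rightarrow> complex \<Rightarrow> bool" where
  "op_eigenvalue T z \<longleftrightarrow> (\<exists>v. v \<noteq> 0 \<and> T v = z *\<^sub>C v)"

definition smallest_eigenvalue :: "('h::complex_inner \<Rightarrow> 'h) \<Rightarrow> real \<Rightarrow> bool" where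
  "smallest_eigenvalue T a \<longleftrightarrow>
     op_eigenvalue T (of_real a) \<and> (\<forall>z. op_eigenvalue T z \<longrightarrow> of_real a \<le> z)"

definition largest_eigenvalue :: "('h::complex_inner \<Rightarrow> 'h) \<Rightarrow> real \<Rightarrow> bool" where
  "largest_eigenvalue T b \<longleftrightarrow>
     op_eigenvalue T (of_real b) \<and> (\<forall>z. op_eigenvalue T z \<longrightarrow> z \<le> of_real b)"

subsection \<open>Matrix, trace and characteristic polynomial (finite dimension)\<close>

definition ordered_basis :: "'h::complex_inner list \<Rightarrow> bool" where
  "ordered_basis bs \<longleftrightarrow> distinct bs \<and> complex_vector.independent (set bs)
     \<and> complex_vector.span (set bs) = UNIV"

definition matrix_wrt :: "'h::complex_inner list \<Rightarrow> ('h \<Rightarrow> 'h) \<Rightarrow> complex mat" where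
  "matrix_wrt bs T = mat (length bs) (length bs)
     (\<lambda>(i, j). complex_vector.representation (set bs) (T (bs ! j)) (bs ! i))"

text \<open>
  The basis is chosen arbitrarily; the lemmas \<open>op_trace_eq\<close> and \<open>op_char_poly_eq\<close>
  below show that the choice is irrelevant.
\<close>

definition op_matrix :: "('h::complex_inner \<Rightarrow> 'h) \<Rightarrow> complex mat" where
  "op_matrix T = matrix_wrt (SOME bs. ordered_basis bs) T"

definition op_trace :: "('h::complex_inner \<Rightarrow> 'h) \<Rightarrow> complex" where
  "op_trace T = (\<Sum>i<dim_row (op_matrix T). op_matrix T $$ (i, i))"

text \<open>The eigenvalues, each repeated according to its algebraic multiplicity.\<close>

definition op_eigenvalues :: "('h::complex_inner \<Rightarrow> 'h) \<Rightarrow> complex multiset" where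
  "op_eigenvalues T = proots (char_poly (op_matrix T))"

lemma clinear_sum:
  assumes "clinear T"
  shows "T (\<Sum>k\<in>K. c k *\<^sub>C f k) = (\<Sum>k\<in>K. c k *\<^sub>C T (f k))"
proof -
  interpret T: Vector_Spaces.linear scaleC scaleC T by (rule assms)
  show ?thesis by (simp add: T.sum T.scale)
qed

lemma sum_representation_nth:
  assumes "ordered_basis bs"
  shows "(\<Sum>k<length bs. complex_vector.representation (set bs) v (bs ! k) *\<^sub>C (bs ! k)) = v"
proof -
  have "v = (\<Sum>b\<in>set bs. complex_vector.representation (set bs) v b *\<^sub>C b)"
    using assms by (intro complex_vector.sum_representation_eq[symmetric]) (auto simp: ordered_basis_def)
  also have "\<dots> = (\<Sum>k<length bs. complex_vector.representation (set bs) v (bs ! k) *\<^sub>C (bs ! k))"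
    using assms by (intro sum.reindex_bij_betw[symmetric] bij_betw_nth) (auto simp: ordered_basis_def)
  finally show ?thesis by simp
qed

lemma representation_sum_nth:
  assumes "ordered_basis bs"
  shows "complex_vector.representation (set bs) (\<Sum>k\<in>K. c k *\<^sub>C f k) b
       = (\<Sum>k\<in>K. c k * complex_vector.representation (set bs) (f k) b)"
  using assms
  by (simp add: ordered_basis_def complex_vector.representation_sum complex_vector.representation_scale)

lemma ordered_basis_length_eq:
  fixes bs cs :: "'h::complex_inner list"
  assumes "ordered_basis bs" "ordered_basis cs"
  shows "length bs = length cs"
proof -
  have "length ds = complex_vector.dim (UNIV :: 'h set)" if "ordered_basis ds" for ds :: "'h list"
    using complex_vector.basis_card_eq_dim[of "set ds" UNIV] that distinct_card[of ds]
    by (simp add: ordered_basis_def)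
  from this[OF assms(1)] this[OF assms(2)] show ?thesis by simp
qed

lemma similar_matrix_wrt:
  fixes bs cs :: "'h::complex_inner list"
  assumes b: "ordered_basis bs" and c: "ordered_basis cs" and T: "clinear T"
  shows "similar_mat (matrix_wrt bs T) (matrix_wrt cs T)"
proof -
  let ?n = "length bs"
  have n: "length cs = ?n" using ordered_basis_length_eq[OF b c] by simp
  let ?r = "\<lambda>ds v i. complex_vector.representation (set ds) v (ds ! i)"
  define P where "P ds es = mat ?n ?n (\<lambda>(i, j). ?r ds (es ! j) i)" for ds es :: "'h list"
  have cmp: "(\<Sum>k<?n. ?r ds (f (es ! k)) i * ?r es w k) = ?r ds (f w) i"
    if d: "ordered_basis ds" and e: "ordered_basis es" and l: "length es = ?n" and f: "clinear f"
    for ds es :: "'h list" and f w i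
  proof -
    have "f w = f (\<Sum>k<?n. ?r es w k *\<^sub>C (es ! k))"
      using sum_representation_nth[OF e, of w] l by simp
    also have "\<dots> = (\<Sum>k<?n. ?r es w k *\<^sub>C f (es ! k))"
      by (rule clinear_sum[OF f])
    finally have "?r ds (f w) i = ?r ds (\<Sum>k<?n. ?r es w k *\<^sub>C f (es ! k)) i" by simp
    then show ?thesis
      by (simp add: representation_sum_nth[OF d] mult.commute)
  qed
  have id: "clinear (\<lambda>v. v)" by (rule complex_vector.linear_ident)
  have one: "P ds es * P es ds = 1\<^sub>m ?n"
    if d: "ordered_basis ds" and e: "ordered_basis es" and l: "length es = ?n" "length ds = ?n"
    for ds es :: "'h list"
  proof (rule eq_matI)
    fix i j assume ij: "i < dim_row (1\<^sub>m ?n)" "j < dim_col (1\<^sub>m ?n)"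
    have "?r ds (ds ! j) i = (if i = j then 1 else 0)"
      using d ij l by (auto simp: ordered_basis_def complex_vector.representation_basis nth_eq_iff_index_eq)
    then show "(P ds es * P es ds) $$ (i, j) = 1\<^sub>m ?n $$ (i, j)"
      using ij l cmp[OF d e l(1) id, of i "ds ! j"]
      by (simp add: P_def scalar_prod_def atLeast0LessThan)
  qed (simp_all add: P_def)
  have "matrix_wrt bs T = P bs cs * matrix_wrt cs T * P cs bs"
  proof (rule eq_matI)
    fix i j assume "i < dim_row (P bs cs * matrix_wrt cs T * P cs bs)"
      "j < dim_col (P bs cs * matrix_wrt cs T * P cs bs)"
    then have ij: "i < ?n" "j < ?n" by (simp_all add: P_def)
    have "(P bs cs * matrix_wrt cs T * P cs bs) $$ (i, j)
      = (\<Sum>l<?n. (\<Sum>k<?n. ?r bs (cs ! k) i * ?r cs (T (cs ! l)) k) * ?r cs (bs ! j) l)"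
      using ij n by (simp add: P_def matrix_wrt_def scalar_prod_def atLeast0LessThan)
    also have "\<dots> = (\<Sum>l<?n. ?r bs (T (cs ! l)) i * ?r cs (bs ! j) l)"
      using cmp[OF b c n id] by simp
    also have "\<dots> = ?r bs (T (bs ! j)) i"
      using cmp[OF b c n T] by simp
    finally show "matrix_wrt bs T $$ (i, j) = (P bs cs * matrix_wrt cs T * P cs bs) $$ (i, j)"
      using ij by (simp add: matrix_wrt_def)
  qed (simp_all add: P_def matrix_wrt_def)
  then have "similar_mat_wit (matrix_wrt bs T) (matrix_wrt cs T) (P bs cs) (P cs bs)"
    using one[OF b c n] one[OF c b _ n] n
    by (auto simp: similar_mat_wit_def Let_def P_def matrix_wrt_def)
  then show ?thesis by (auto simp: similar_mat_def)
qed

lemma op_char_poly_eq: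
  assumes "ordered_basis bs" "clinear T"
  shows "char_poly (op_matrix T) = char_poly (matrix_wrt bs T)"
  unfolding op_matrix_def
  using assms by (intro char_poly_similar similar_matrix_wrt) (auto intro: someI)

lemma op_trace_eq:
  fixes T :: "'h::complex_inner \<Rightarrow> 'h"
  assumes b: "ordered_basis bs" and T: "clinear T"
  shows "op_trace T = (\<Sum>i<length bs. complex_vector.representation (set bs) (T (bs ! i)) (bs ! i))"
proof -
  define cs :: "'h list" where "cs = (SOME bs. ordered_basis bs)"
  have c: "ordered_basis cs" unfolding cs_def using b by (rule someI)
  let ?r = "\<lambda>ds v i. complex_vector.representation (set ds) v (ds ! i)"
  have exp: "?r ds (T v) i = (\<Sum>k<length es. ?r es v k * ?r ds (T (es ! k)) i)"
    if d: "ordered_basis ds" and e: "ordered_basis es" and T: "clinear T" for ds es i v and T :: "'h \<Rightarrow> 'h"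
  proof -
    have "T v = T (\<Sum>k<length es. ?r es v k *\<^sub>C (es ! k))"
      using sum_representation_nth[OF e, of v] by simp
    also have "\<dots> = (\<Sum>k<length es. ?r es v k *\<^sub>C T (es ! k))"
      by (rule clinear_sum[OF T])
    finally show ?thesis by (simp add: representation_sum_nth[OF d])
  qed
  have id: "clinear (\<lambda>v. v)" by (rule complex_vector.linear_ident)
  have "op_trace T = (\<Sum>i<length cs. ?r cs (T (cs ! i)) i)"
    by (simp add: op_trace_def op_matrix_def matrix_wrt_def cs_def)
  also have "\<dots> = (\<Sum>i<length cs. \<Sum>k<length bs. ?r bs (cs ! i) k * ?r cs (T (bs ! k)) i)"
    by (intro sum.cong refl exp[OF c b T])
  also have "\<dots> = (\<Sum>k<length bs. \<Sum>i<length cs. ?r cs (T (bs ! k)) i * ?r bs (cs ! i) k)"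
    by (subst sum.swap) (simp add: mult.commute)
  also have "\<dots> = (\<Sum>k<length bs. ?r bs (T (bs ! k)) k)"
    by (intro sum.cong refl exp[OF b c id, symmetric])
  finally show ?thesis .
qed

section \<open>Weak integrals and square-integrable functions\<close>

definition has_weak_integral :: "'a measure \<Rightarrow> ('a \<Rightarrow> 'h::complex_inner) \<Rightarrow> 'h \<Rightarrow> bool" where
  "has_weak_integral M F v \<longleftrightarrow> (\<forall>g. has_bochner_integral M (\<lambda>\<alpha>. \<langle>F \<alpha>, g\<rangle>) \<langle>v, g\<rangle>)"

definition weakly_integrable :: "'a measure \<Rightarrow> ('a \<Rightarrow> 'h::complex_inner) \<Rightarrow> bool" where
  "weakly_integrable M F \<longleftrightarrow> (\<exists>v. has_weak_integral M F v)"

definition weak_integral :: "'a measure \<Rightarrow> ('a \<Rightarrow> 'h::complex_inner) \<Rightarrow> 'h" where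
  "weak_integral M F = (THE v. has_weak_integral M F v)"

lemma weak_integral_eqI:
  assumes "has_weak_integral M F v"
  shows "weak_integral M F = v"
  unfolding weak_integral_def
proof (rule the_equality[where P = "has_weak_integral M F", OF assms])
  fix w assume "has_weak_integral M F w"
  then have eq: "\<langle>w, g\<rangle> = \<langle>v, g\<rangle>" for g
    using assms has_bochner_integral_eq unfolding has_weak_integral_def by blast
  have "\<langle>w - v, w - v\<rangle> + \<langle>v, w - v\<rangle> = \<langle>w, w - v\<rangle>"
    by (simp add: cinner_add_left[symmetric])
  then have "\<langle>w - v, w - v\<rangle> = 0" using eq by simp
  then show "w = v" by (simp add: cinner_eq_zero_iff)
qed

definition square_integrable :: "'a measure \<Rightarrow> ('a \<Rightarrow> complex) \<Rightarrow> bool" where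
  "square_integrable M f \<longleftrightarrow>
     f \<in> borel_measurable M \<and> integrable M (\<lambda>\<alpha>. (norm (f \<alpha>))\<^sup>2)"

definition L2_fun_norm :: "'a measure \<Rightarrow> ('a \<Rightarrow> complex) \<Rightarrow> real" where
  "L2_fun_norm M f = sqrt (\<integral>\<alpha>. (norm (f \<alpha>))\<^sup>2 \<partial>M)"

section \<open>Continuous frames\<close>

definition analysis_op :: "('a \<Rightarrow> 'h::complex_inner) \<Rightarrow> 'h \<Rightarrow> 'a \<Rightarrow> complex" where
  "analysis_op x h = (\<lambda>\<alpha>. \<langle>h, x \<alpha>\<rangle>)"

text \<open>
  Elements of \<open>\<L>\<^sup>2\<close> are represented by functions, hence linearity is required almost everywhere.
\<close>

definition bounded_linear_to_L2 :: "'a measure \<Rightarrow> ('h::complex_inner \<Rightarrow> 'a \<Rightarrow> complex) \<Rightarrow> bool" where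
  "bounded_linear_to_L2 M \<Theta> \<longleftrightarrow>
     (\<forall>h. square_integrable M (\<Theta> h)) \<and>
     (\<forall>g h. AE \<alpha> in M. \<Theta> (g + h) \<alpha> = \<Theta> g \<alpha> + \<Theta> h \<alpha>) \<and>
     (\<forall>c h. AE \<alpha> in M. \<Theta> (c *\<^sub>C h) \<alpha> = c * \<Theta> h \<alpha>) \<and>
     (\<exists>K. \<forall>h. L2_fun_norm M (\<Theta> h) \<le> K * norm h)"

definition frame_operator ::
  "'a measure \<Rightarrow> ('a \<Rightarrow> 'h::complex_inner) \<Rightarrow> ('a \<Rightarrow> 'h) \<Rightarrow> 'h \<Rightarrow> 'h" where
  "frame_operator M x \<tau> h = weak_integral M (\<lambda>\<alpha>. \<langle>h, x \<alpha>\<rangle> *\<^sub>C \<tau> \<alpha>)"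

definition continuous_frame ::
  "'a measure \<Rightarrow> ('a \<Rightarrow> 'h::complex_inner) \<Rightarrow> ('a \<Rightarrow> 'h) \<Rightarrow> bool" where
  "continuous_frame M x \<tau> \<longleftrightarrow>
     (\<forall>h. (\<lambda>\<alpha>. \<langle>h, x \<alpha>\<rangle>) \<in> borel_measurable M \<and> (\<lambda>\<alpha>. \<langle>h, \<tau> \<alpha>\<rangle>) \<in> borel_measurable M) \<and>
     (\<forall>h. weakly_integrable M (\<lambda>\<alpha>. \<langle>h, x \<alpha>\<rangle> *\<^sub>C \<tau> \<alpha>)) \<and>
     bounded_clinear (frame_operator M x \<tau>) \<and>
     positive_op (frame_operator M x \<tau>) \<and>
     invertible_op (frame_operator M x \<tau>) \<and>
     bounded_linear_to_L2 M (analysis_op x) \<and>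
     bounded_linear_to_L2 M (analysis_op \<tau>)"

definition lower_frame_bound ::
  "'a measure \<Rightarrow> ('a \<Rightarrow> 'h::complex_inner) \<Rightarrow> ('a \<Rightarrow> 'h) \<Rightarrow> real \<Rightarrow> bool" where
  "lower_frame_bound M x \<tau> a \<longleftrightarrow>
     a > 0 \<and> (\<forall>h. of_real (a * (norm h)\<^sup>2) \<le> \<langle>frame_operator M x \<tau> h, h\<rangle>)"

definition upper_frame_bound ::
  "'a measure \<Rightarrow> ('a \<Rightarrow> 'h::complex_inner) \<Rightarrow> ('a \<Rightarrow> 'h) \<Rightarrow> real \<Rightarrow> bool" where
  "upper_frame_bound M x \<tau> b \<longleftrightarrow>
     b > 0 \<and> (\<forall>h. \<langle>frame_operator M x \<tau> h, h\<rangle> \<le> of_real (b * (norm h)\<^sup>2))"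

definition optimal_lower_frame_bound ::
  "'a measure \<Rightarrow> ('a \<Rightarrow> 'h::complex_inner) \<Rightarrow> ('a \<Rightarrow> 'h) \<Rightarrow> real \<Rightarrow> bool" where
  "optimal_lower_frame_bound M x \<tau> a \<longleftrightarrow>
     lower_frame_bound M x \<tau> a \<and> (\<forall>a'. lower_frame_bound M x \<tau> a' \<longrightarrow> a' \<le> a)"

definition optimal_upper_frame_bound ::
  "'a measure \<Rightarrow> ('a \<Rightarrow> 'h::complex_inner) \<Rightarrow> ('a \<Rightarrow> 'h) \<Rightarrow> real \<Rightarrow> bool" where
  "optimal_upper_frame_bound M x \<tau> b \<longleftrightarrow>
     upper_frame_bound M x \<tau> b \<and> (\<forall>b'. upper_frame_bound M x \<tau> b' \<longrightarrow> b \<le> b')"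

definition tight_frame ::
  "'a measure \<Rightarrow> ('a \<Rightarrow> 'h::complex_inner) \<Rightarrow> ('a \<Rightarrow> 'h) \<Rightarrow> real \<Rightarrow> bool" where
  "tight_frame M x \<tau> b \<longleftrightarrow>
     continuous_frame M x \<tau> \<and> b > 0 \<and> frame_operator M x \<tau> = (\<lambda>h. of_real b *\<^sub>C h)"

definition parseval_frame ::
  "'a measure \<Rightarrow> ('a \<Rightarrow> 'h::complex_inner) \<Rightarrow> ('a \<Rightarrow> 'h) \<Rightarrow> bool" where
  "parseval_frame M x \<tau> \<longleftrightarrow> continuous_frame M x \<tau> \<and> frame_operator M x \<tau> = id"

end

theory Submission
  imports Defs
begin

text \<open>
  On a complex space the positive operator \<open>S\<close> is self-adjoint, so in finite dimension it has an
  orthonormal eigenbasis \<open>B\<close>. Everything about eigenvalues, bounds, norms and \<open>Trace S\<close> is read off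
  in this basis. For the integrals, expanding \<open>\<tau>\<^sub>\<alpha>\<close> in \<open>B\<close> inside \<open>\<langle>T \<tau>\<^sub>\<alpha>, x\<^sub>\<alpha>\<rangle>\<close> and integrating
  termwise gives \<open>\<integral> \<langle>T \<tau>\<^sub>\<alpha>, x\<^sub>\<alpha>\<rangle> = Trace (S T)\<close>; the inner integrals of the double integrals equal
  \<open>\<langle>S \<tau>\<^sub>\<alpha>, x\<^sub>\<alpha>\<rangle>\<close>. Self-adjointness of \<open>S\<close> makes all of this symmetric in \<open>x\<close> and \<open>\<tau>\<close>.
\<close>

section \<open>Orthonormal bases\<close>

lemma cinner_sum_left: "\<langle>\<Sum>i\<in>I. f i, y\<rangle> = (\<Sum>i\<in>I. \<langle>f i, y\<rangle>)"
proof -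
  have zero: "\<langle>0, y\<rangle> = 0"
    using cinner_scaleC_left[of 0 0 y] by simp
  show ?thesis
    by (induction I rule: infinite_finite_induct) (simp_all add: zero cinner_add_left)
qed

lemma cinner_scaleC_right: "\<langle>x, a *\<^sub>C y\<rangle> = cnj a * \<langle>x, y\<rangle>"
  by (subst cinner_commute) (simp add: cinner_scaleC_left flip: cinner_commute[of x])

lemma cinner_add_right: "\<langle>x, y + z\<rangle> = \<langle>x, y\<rangle> + \<langle>x, z\<rangle>"
  by (subst cinner_commute) (simp add: cinner_add_left flip: cinner_commute[of x])

lemma cinner_zero [simp]: "\<langle>0, x\<rangle> = 0" "\<langle>x, 0\<rangle> = 0"
  using cinner_scaleC_left[of 0 0 x] cinner_scaleC_right[of x 0 0] by simp_all

lemma cinner_diff_left: "\<langle>x - y, z\<rangle> = \<langle>x, z\<rangle> - \<langle>y, z\<rangle>"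
  using cinner_add_left[of "x - y" y z] by simp

lemma cinner_self: "\<langle>x, x\<rangle> = of_real ((norm x)\<^sup>2)"
  using cinner_ge_zero[of x]
  by (simp add: norm_eq_sqrt_cinner less_eq_complex_def complex_eq_iff)

text \<open>The norm axioms only give homogeneity for real scalars. The complex case follows by
  comparing squared norms through the inner product.\<close>

lemma norm_scaleC: "norm (a *\<^sub>C x) = cmod a * norm x"
proof -
  have "\<langle>a *\<^sub>C x, a *\<^sub>C x\<rangle> = of_real ((cmod a)\<^sup>2) * \<langle>x, x\<rangle>"
    by (simp add: cinner_scaleC_left cinner_scaleC_right complex_norm_square del: of_real_power)
  then have "complex_of_real ((norm (a *\<^sub>C x))\<^sup>2) = of_real ((cmod a * norm x)\<^sup>2)"
    by (simp add: cinner_self power_mult_distrib)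
  then show ?thesis
    by (simp only: of_real_eq_iff power2_eq_iff_nonneg norm_ge_zero mult_nonneg_nonneg)
qed

definition orthonormal :: "'h::complex_inner set \<Rightarrow> bool" where
  "orthonormal B \<longleftrightarrow> (\<forall>b\<in>B. \<forall>c\<in>B. \<langle>b, c\<rangle> = (if b = c then 1 else 0))"

text \<open>Pairing with \<open>c\<close> kills every term but its own. With \<open>F = B\<close>
  this reads off coefficients; with finite subsets of a possibly infinite \<open>B\<close> it gives
  independence.\<close>

lemma orthonormal_cinner_sum:
  assumes "orthonormal B" "finite F" "F \<subseteq> B" "c \<in> B"
  shows "\<langle>\<Sum>b\<in>F. u b *\<^sub>C b, c\<rangle> = (if c \<in> F then u c else 0)"
proof -
  have "\<langle>\<Sum>b\<in>F. u b *\<^sub>C b, c\<rangle> = (\<Sum>b\<in>F. if b = c then u b else 0)"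
    using assms unfolding cinner_sum_left
    by (intro sum.cong) (auto simp: cinner_scaleC_left orthonormal_def)
  then show ?thesis using assms(2) by simp
qed

lemma orthonormal_independent:
  assumes "orthonormal B"
  shows "complex_vector.independent B"
proof
  assume "complex_vector.dependent B"
  then obtain F u v where F: "finite F" "F \<subseteq> B" and zero: "(\<Sum>b\<in>F. u b *\<^sub>C b) = 0"
    and v: "v \<in> F" "u v \<noteq> 0"
    unfolding complex_vector.dependent_explicit by blast
  have "u v = \<langle>\<Sum>b\<in>F. u b *\<^sub>C b, v\<rangle>"
    using orthonormal_cinner_sum[OF assms F, of v u] F v by auto
  then show False using zero v by simp
qed

text \<open>Finiteness is built in because a sum over an infinite set defaults to 0. Independence is
  implied by orthonormality.\<close>

definition onb :: "'h::complex_inner set \<Rightarrow> bool" where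
  "onb B \<longleftrightarrow> finite B \<and> orthonormal B \<and> complex_vector.span B = UNIV"

lemma onb_expand:
  assumes "onb B"
  shows "(\<Sum>b\<in>B. \<langle>v, b\<rangle> *\<^sub>C b) = v"
proof -
  have B: "finite B" "orthonormal B" using assms by (simp_all add: onb_def)
  have "v \<in> range (\<lambda>u. \<Sum>b\<in>B. u b *\<^sub>C b)"
    using assms complex_vector.span_finite[of B] by (simp add: onb_def)
  then obtain u where v: "v = (\<Sum>b\<in>B. u b *\<^sub>C b)" by blast
  have "\<langle>v, b\<rangle> = u b" if "b \<in> B" for b
    using orthonormal_cinner_sum[OF B(2,1) order_refl that, of u] that v by simp
  then show ?thesis using v by simp
qed

text \<open>Parseval's identity in polarized form, obtained by expanding \<open>g\<close>.\<close>

lemma onb_cinner: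
  assumes "onb B"
  shows "\<langle>g, h\<rangle> = (\<Sum>b\<in>B. \<langle>g, b\<rangle> * \<langle>b, h\<rangle>)"
  by (subst onb_expand[OF assms, of g, symmetric]) (simp add: cinner_sum_left cinner_scaleC_left)

lemma onb_norm_square:
  assumes "onb B"
  shows "(norm h)\<^sup>2 = (\<Sum>b\<in>B. (cmod \<langle>h, b\<rangle>)\<^sup>2)"
proof -
  have "complex_of_real ((norm h)\<^sup>2) = of_real (\<Sum>b\<in>B. (cmod \<langle>h, b\<rangle>)\<^sup>2)"
    unfolding cinner_self[symmetric] onb_cinner[OF assms, of h h]
    by (simp add: complex_norm_square cinner_commute[of _ h] del: of_real_power)
  then show ?thesis by (simp only: of_real_eq_iff)
qed

text \<open>Coordinates are unique, so those given by the Fourier expansion are the ones on which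
  \<open>op_matrix\<close> and \<open>op_trace\<close> are built.\<close>

lemma onb_representation:
  assumes "onb B" "b \<in> B"
  shows "complex_vector.representation B v b = \<langle>v, b\<rangle>"
proof -
  have B: "finite B" "orthonormal B" "complex_vector.span B = UNIV"
    using assms by (simp_all add: onb_def)
  have "v = (\<Sum>c\<in>B. complex_vector.representation B v c *\<^sub>C c)"
    using B by (intro complex_vector.sum_representation_eq[symmetric])
      (auto simp: orthonormal_independent)
  then show ?thesis
    using orthonormal_cinner_sum[OF B(2,1) order_refl assms(2), of "complex_vector.representation B v"]
      assms(2) by simp
qed

section \<open>Dimension, trace and spectrum computed in an orthonormal basis\<close>

lemma onb_card:
  assumes "onb (B :: 'h::complex_inner set)"
  shows "card B = complex_vector.dim (UNIV :: 'h set)"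
  using assms complex_vector.basis_card_eq_dim[of B UNIV]
  by (simp add: onb_def orthonormal_independent)

lemma onb_list:
  assumes "onb B"
  obtains bs where "ordered_basis bs" "set bs = B" "distinct bs"
proof -
  obtain bs where "set bs = B" "distinct bs"
    using assms finite_distinct_list unfolding onb_def by blast
  then show thesis
    using assms that by (simp add: ordered_basis_def onb_def orthonormal_independent)
qed

lemma onb_trace:
  assumes B: "onb B" and T: "clinear T"
  shows "op_trace T = (\<Sum>b\<in>B. \<langle>T b, b\<rangle>)"
proof -
  obtain bs where bs: "ordered_basis bs" "set bs = B" "distinct bs"
    using onb_list[OF B] .
  have "op_trace T = (\<Sum>i<length bs. \<langle>T (bs ! i), bs ! i\<rangle>)"
    unfolding op_trace_eq[OF bs(1) T] bs(2)
    by (intro sum.cong refl onb_representation[OF B]) (use bs in auto)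
  also have "\<dots> = (\<Sum>b\<in>B. \<langle>T b, b\<rangle>)"
    using bs by (intro sum.reindex_bij_betw bij_betw_nth) auto
  finally show ?thesis .
qed

text \<open>In a basis of eigenvectors the matrix is diagonal, in particular upper triangular, so
  its characteristic polynomial is the product of the linear factors given by the diagonal entries,
  and its roots are these entries with multiplicity.\<close>

lemma op_eigenvalues_onb:
  assumes B: "onb B" and T: "clinear T" and eig: "\<And>b. b \<in> B \<Longrightarrow> T b = l b *\<^sub>C b"
  shows "op_eigenvalues T = image_mset l (mset_set B)"
proof -
  obtain bs where bs: "ordered_basis bs" "set bs = B" "distinct bs"
    using onb_list[OF B] .
  let ?A = "matrix_wrt bs T"
  have entry: "?A $$ (i, j) = (if i = j then l (bs ! i) else 0)"
    if "i < length bs" "j < length bs" for i j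
  proof -
    have mem: "bs ! i \<in> B" "bs ! j \<in> B" using that bs by auto
    then have "?A $$ (i, j) = \<langle>l (bs ! j) *\<^sub>C bs ! j, bs ! i\<rangle>"
      using that bs onb_representation[OF B] eig by (simp add: matrix_wrt_def)
    then show ?thesis
      using B mem bs that
      by (auto simp: cinner_scaleC_left onb_def orthonormal_def nth_eq_iff_index_eq)
  qed
  have A: "?A \<in> carrier_mat (length bs) (length bs)"
    by (simp add: matrix_wrt_def)
  have "upper_triangular ?A"
    unfolding upper_triangular_def using A entry by auto
  moreover have "diag_mat ?A = map l bs"
    using carrier_matD[OF A] entry by (intro nth_equalityI) (simp_all add: diag_mat_def)
  ultimately have "char_poly ?A = (\<Prod>a\<leftarrow>map l bs. [:- a, 1:])"
    using char_poly_upper_triangular[OF A] by simp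
  moreover have "proots (\<Prod>a\<leftarrow>as. [:- a, 1:]) = mset as" for as :: "complex list"
  proof (induction as)
    case (Cons a as)
    have "(\<Prod>a\<leftarrow>as. [:- a, 1:]) \<noteq> (0 :: complex poly)"
      by (auto simp: prod_list_zero_iff)
    then show ?case
      using Cons by (simp add: proots_mult del: mult_pCons_left)
  qed simp
  ultimately have "proots (char_poly ?A) = mset (map l bs)" by metis
  then show ?thesis
    unfolding op_eigenvalues_def op_char_poly_eq[OF bs(1) T]
    using bs by (simp flip: mset_set_set)
qed

section \<open>The spectral theorem for positive operators\<close>

text \<open>On a complex space, positivity alone forces self-adjointness, by polarization.\<close>

lemma positive_op_selfadjoint:
  assumes T: "clinear T" and pos: "positive_op T"
  shows "\<langle>T g, h\<rangle> = \<langle>g, T h\<rangle>"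
proof -
  interpret T: Vector_Spaces.linear scaleC scaleC T by (rule T)
  have im: "Im \<langle>T v, v\<rangle> = 0" for v
    using pos by (simp add: positive_op_def less_eq_complex_def)
  \<comment> \<open>All values of the quadratic form are real, so in its expansion at
    \<open>c *\<^sub>C g + h\<close> the cross terms must be real too.\<close>
  have "Im (c * \<langle>T g, h\<rangle> + cnj c * \<langle>T h, g\<rangle>) = 0" for c
  proof -
    have "\<langle>T (c *\<^sub>C g + h), c *\<^sub>C g + h\<rangle>
      = of_real ((cmod c)\<^sup>2) * \<langle>T g, g\<rangle> + \<langle>T h, h\<rangle> + (c * \<langle>T g, h\<rangle> + cnj c * \<langle>T h, g\<rangle>)"
      by (simp add: T.add T.scale cinner_add_left cinner_add_right cinner_scaleC_left
          cinner_scaleC_right complex_norm_square algebra_simps del: of_real_power)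
    then show ?thesis using im[of g] im[of h] im[of "c *\<^sub>C g + h"] by simp
  qed
  \<comment> \<open>\<open>c = 1\<close> matches the imaginary parts, \<open>c = \<i>\<close> the
    real parts.\<close>
  from this[of 1] this[of \<i>] have "\<langle>T g, h\<rangle> = cnj \<langle>T h, g\<rangle>"
    by (simp add: complex_eq_iff)
  then show ?thesis by (simp add: cinner_commute[of g])
qed

section \<open>Polynomials in an operator, applied to a fixed vector\<close>

context
  fixes T :: "'h::complex_inner \<Rightarrow> 'h" and v :: 'h
  assumes T: "clinear T"
begin

interpretation T: Vector_Spaces.linear scaleC scaleC T by (rule T)

text \<open>This is \<open>p(T) v\<close>, evaluated by Horner's scheme directly in the vector
  space, so that no ring of operators has to be set up.\<close>

definition orbit_poly :: "complex poly \<Rightarrow> 'h" where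
  "orbit_poly p = fold_coeffs (\<lambda>c u. c *\<^sub>C v + T u) p 0"

lemma orbit_poly_0 [simp]: "orbit_poly 0 = 0"
  by (simp add: orbit_poly_def)

lemma orbit_poly_pCons [simp]: "orbit_poly (pCons c p) = c *\<^sub>C v + T (orbit_poly p)"
  \<comment> \<open>\<open>pCons 0 0\<close> is the zero polynomial and has no coefficient to fold;
    in that case the equation rests on \<open>T 0 = 0\<close>.\<close>
  by (cases "c = 0 \<and> p = 0") (auto simp: orbit_poly_def T.zero)

lemma orbit_poly_add: "orbit_poly (p + q) = orbit_poly p + orbit_poly q"
  by (induction p q rule: poly_induct2) (simp_all add: T.add scaleC_add_left)

lemma orbit_poly_smult: "orbit_poly (Polynomial.smult c p) = c *\<^sub>C orbit_poly p"
  by (induction p) (simp_all add: T.scale scaleC_add_right scaleC_scaleC)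

lemma orbit_poly_sum: "orbit_poly (\<Sum>i\<in>I. f i) = (\<Sum>i\<in>I. orbit_poly (f i))"
  by (induction I rule: infinite_finite_induct) (simp_all add: orbit_poly_add)

lemma orbit_poly_monom: "orbit_poly (monom c n) = c *\<^sub>C (T ^^ n) v"
  by (induction n) (simp_all add: monom_0 monom_Suc T.zero T.scale)

text \<open>The iterates of \<open>v\<close> with exponents 0 to \<open>card A\<close> outnumber a
  spanning set, so they satisfy a non-trivial relation, whose coefficients form \<open>p\<close>.
  Dependence is a property of sets, so a repetition among the iterates is a separate case.\<close>

lemma orbit_poly_annihilator:
  fixes A :: "'h set"
  assumes fin: "finite A" "complex_vector.span A = UNIV"
  obtains p where "p \<noteq> 0" "orbit_poly p = 0"
proof -
  let ?f = "\<lambda>i. (T ^^ i) v" and ?I = "{..card A}"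
  show thesis
  proof (cases "inj_on ?f ?I")
    case True
    have "complex_vector.dependent (?f ` ?I)"
    proof (rule ccontr)
      assume "complex_vector.independent (?f ` ?I)"
      then have "card (?f ` ?I) \<le> card A"
        using complex_vector.independent_span_bound[of A "?f ` ?I"] fin by simp
      then show False using card_image[OF True] by simp
    qed
    then obtain u i where u: "(\<Sum>w\<in>?f ` ?I. u w *\<^sub>C w) = 0" and i: "i \<in> ?I" "u (?f i) \<noteq> 0"
      using complex_vector.dependent_finite[of "?f ` ?I"] by auto
    define p where "p = (\<Sum>j\<in>?I. monom (u (?f j)) j)"
    have "coeff p i = u (?f i)"
      using i by (simp add: p_def coeff_sum)
    then have "p \<noteq> 0" using i by auto
    moreover have "orbit_poly p = 0"
      using u by (simp add: p_def orbit_poly_sum orbit_poly_monom sum.reindex[OF True])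
    ultimately show thesis by (rule that)
  next
    case False
    then obtain i j where ij: "i \<noteq> j" "?f i = ?f j" by (auto simp: inj_on_def)
    \<comment> \<open>A repeated iterate is itself the relation, encoded by
      \<open>X^i - X^j\<close>.\<close>
    define p where "p = monom (1 :: complex) i - monom 1 j"
    have "coeff p i = 1" using ij by (simp add: p_def)
    then have "p \<noteq> 0" by auto
    moreover have "orbit_poly p + orbit_poly (monom 1 j) = orbit_poly (monom 1 i)"
      by (simp add: p_def flip: orbit_poly_add)
    then have "orbit_poly p = 0"
      using ij by (simp add: orbit_poly_monom)
    ultimately show thesis by (rule that)
  qed
qed

text \<open>
  If \<open>p\<close> has minimal degree among the polynomials with \<open>p(T)v = 0\<close> and \<open>p = (X - z) q\<close>, then
  \<open>q(T)v\<close> is an eigenvector. It lies in every invariant subspace containing \<open>v\<close>.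
\<close>

lemma invariant_subspace_eigenvector:
  fixes A :: "'h set"
  assumes fin: "finite A" "complex_vector.span A = UNIV"
    and W: "complex_vector.subspace W" "\<And>w. w \<in> W \<Longrightarrow> T w \<in> W" and v: "v \<in> W" "v \<noteq> 0"
  obtains w z where "w \<in> W" "w \<noteq> 0" "T w = z *\<^sub>C w"
proof -
  define p where "p = arg_min degree (\<lambda>p. p \<noteq> 0 \<and> orbit_poly p = 0)"
  have p: "p \<noteq> 0" "orbit_poly p = 0"
    using orbit_poly_annihilator[OF fin]
      arg_min_natI[of "\<lambda>p. p \<noteq> 0 \<and> orbit_poly p = 0" _ degree]
    unfolding p_def by blast+
  have minimal: "degree p \<le> degree q" if "q \<noteq> 0" "orbit_poly q = 0" for q
    using arg_min_nat_le[of "\<lambda>p. p \<noteq> 0 \<and> orbit_poly p = 0" q degree] that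
    unfolding p_def by blast
  have "degree p \<noteq> 0"
  proof
    assume "degree p = 0"
    then obtain c where "p = [:c:]" by (rule degree_eq_zeroE)
    \<comment> \<open>A non-zero constant annihilator would give \<open>c *\<^sub>C v = 0\<close>
      although \<open>v \<noteq> 0\<close>.\<close>
    then show False using p v by (simp add: T.zero)
  qed
  then obtain z where "poly p z = 0"
    using fundamental_theorem_of_algebra[of p] constant_degree[of p] by metis
  then obtain q where q: "p = [:- z, 1:] * q" using poly_eq_0_iff_dvd by (metis dvdE)
  have "q \<noteq> 0" using p(1) q by (metis mult_zero_right)
  then have "degree q < degree p" unfolding q by (simp add: degree_mult_eq del: mult_pCons_left)
  then have "orbit_poly q \<noteq> 0" using minimal[OF \<open>q \<noteq> 0\<close>] by (meson leD)
  moreover have "T (orbit_poly q) = z *\<^sub>C orbit_poly q"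
  proof -
    \<comment> \<open>In the form \<open>X q = p + z q\<close> the factorization can be evaluated
      termwise: multiplication by \<open>X\<close> becomes \<open>T\<close>, and \<open>p\<close>
      contributes 0.\<close>
    have "p + Polynomial.smult z q = pCons 0 q" unfolding q by simp
    then have "orbit_poly p + z *\<^sub>C orbit_poly q = orbit_poly (pCons 0 q)"
      by (simp only: flip: orbit_poly_add orbit_poly_smult)
    then show ?thesis using p(2) by simp
  qed
  moreover have "orbit_poly q \<in> W"
    by (induction q) (use W v in \<open>simp_all add: complex_vector.subspace_0
        complex_vector.subspace_add complex_vector.subspace_scale\<close>)
  ultimately show thesis using that by blast
qed

end

text \<open>
  An orthonormal set of eigenvectors of maximal cardinality spans: otherwise its orthogonal
  complement is a non-zero invariant subspace and contributes another eigenvector.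
\<close>

theorem selfadjoint_eigenbasis:
  fixes T :: "'h::complex_inner \<Rightarrow> 'h"
  assumes T: "clinear T" and sa: "\<And>g h. \<langle>T g, h\<rangle> = \<langle>g, T h\<rangle>"
    and fin: "finite A" "complex_vector.span A = (UNIV :: 'h set)"
  obtains B l where "onb B" "\<And>b. b \<in> B \<Longrightarrow> T b = of_real (l b) *\<^sub>C b"
proof -
  define P where "P B \<longleftrightarrow> orthonormal B \<and> (\<forall>b\<in>B. \<exists>z. T b = z *\<^sub>C b)" for B
  have bound: "finite B \<and> card B \<le> card A" if "P B" for B
    using that complex_vector.independent_span_bound[of A B] fin orthonormal_independent[of B]
    by (simp add: P_def)
  \<comment> \<open>The empty set satisfies \<open>P\<close> and no such set has more than
    \<open>card A\<close> elements, so a maximal cardinality is attained.\<close>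
  obtain B where B: "P B" and max: "\<And>C. P C \<Longrightarrow> card C \<le> card B"
    using ex_has_greatest_nat[of P "{}" card "Suc (card A)"] bound
    by (auto simp: P_def orthonormal_def less_Suc_eq_le)
  have on: "orthonormal B" and finB: "finite B" using B bound by (auto simp: P_def)
  have "complex_vector.span B = UNIV"
  proof (rule ccontr)
    assume "complex_vector.span B \<noteq> UNIV"
    then obtain u where u: "u \<notin> complex_vector.span B" by auto
    define W where "W = {w. \<forall>b\<in>B. \<langle>w, b\<rangle> = 0}"
    \<comment> \<open>\<open>v\<close> is \<open>u\<close> minus its orthogonal projection to the
      span of \<open>B\<close>.\<close>
    define v where "v = u - (\<Sum>b\<in>B. \<langle>u, b\<rangle> *\<^sub>C b)"
    have "(\<Sum>b\<in>B. \<langle>u, b\<rangle> *\<^sub>C b) \<in> complex_vector.span B"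
      by (intro complex_vector.span_sum complex_vector.span_scale complex_vector.span_base)
    then have "v \<noteq> 0" using u by (auto simp: v_def)
    moreover have "v \<in> W"
      using orthonormal_cinner_sum[OF on finB order_refl]
      by (simp add: W_def v_def cinner_diff_left)
    moreover have "complex_vector.subspace W"
      by (auto simp: W_def complex_vector.subspace_def cinner_add_left cinner_scaleC_left)
    \<comment> \<open>Self-adjointness moves \<open>T\<close> onto the eigenvector \<open>b\<close>,
      which is only rescaled, so orthogonality to \<open>b\<close> survives.\<close>
    moreover have "T w \<in> W" if "w \<in> W" for w
      using that B by (auto simp: W_def P_def sa cinner_scaleC_right)
    ultimately obtain w z where w: "w \<in> W" "w \<noteq> 0" "T w = z *\<^sub>C w"
      using invariant_subspace_eigenvector[OF T fin] by metis
    define e where "e = complex_of_real (inverse (norm w)) *\<^sub>C w"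
    have orth: "\<langle>e, b\<rangle> = 0 \<and> \<langle>b, e\<rangle> = 0" if "b \<in> B" for b
      using w(1) that cinner_commute[of b w]
      by (simp add: e_def W_def cinner_scaleC_left cinner_scaleC_right)
    have "norm e = 1"
      using w(2) by (simp add: e_def norm_scaleC norm_inverse)
    then have unit: "\<langle>e, e\<rangle> = 1" by (simp add: cinner_self)
    interpret T: Vector_Spaces.linear scaleC scaleC T by (rule T)
    have "T e = z *\<^sub>C e"
      by (simp add: e_def T.scale w(3) scaleC_scaleC mult.commute)
    then have "P (insert e B)"
      using B orth unit by (auto simp: P_def orthonormal_def)
    moreover have "e \<notin> B" using orth unit by auto
    ultimately show False using max[of "insert e B"] finB by simp
  qed
  then have onb: "onb B" using on finB by (simp add: onb_def)
  \<comment> \<open>On a unit eigenvector the quadratic form returns the eigenvalue, and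
    self-adjointness makes it real.\<close>
  have "T b = of_real (Re \<langle>T b, b\<rangle>) *\<^sub>C b" if b: "b \<in> B" for b
  proof -
    obtain z where z: "T b = z *\<^sub>C b" using B b unfolding P_def by blast
    have "\<langle>b, b\<rangle> = 1" using on b by (simp add: orthonormal_def)
    then have "z = cnj z" using sa[of b b] by (simp add: z cinner_scaleC_left cinner_scaleC_right)
    then have "of_real (Re z) = z" by (simp add: complex_eq_iff)
    then show ?thesis using z \<open>\<langle>b, b\<rangle> = 1\<close> by (simp add: cinner_scaleC_left)
  qed
  then show thesis by (rule that[OF onb])
qed

section \<open>Operators with an orthonormal eigenbasis\<close>

text \<open>\<open>B\<close> is non-empty so that the extreme eigenvalues exist. Abstracting over
  the operator lets the results serve both the frame operator and its inverse.\<close>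

locale eigenbasis =
  fixes T :: "'h::complex_inner \<Rightarrow> 'h" and B :: "'h set" and l :: "'h \<Rightarrow> real"
  assumes clinear: "clinear T" and onb: "onb B" and nonempty: "B \<noteq> {}"
    and eigen: "\<And>b. b \<in> B \<Longrightarrow> T b = of_real (l b) *\<^sub>C b"
    and nonneg: "\<And>b. b \<in> B \<Longrightarrow> 0 \<le> l b"
begin

lemma finite: "finite B"
  using onb by (simp add: onb_def)

lemma basis_norm:
  assumes "b \<in> B"
  shows "norm b = 1"
proof -
  have "complex_of_real ((norm b)\<^sup>2) = of_real 1"
    using onb assms unfolding cinner_self[symmetric] by (simp add: onb_def orthonormal_def)
  then have "(norm b)\<^sup>2 = 1" by (simp only: of_real_eq_iff)
  then show ?thesis by (simp add: power2_eq_1_iff) (use norm_ge_zero[of b] in linarith)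
qed

lemma basis_nonzero: "b \<in> B \<Longrightarrow> b \<noteq> 0"
  using basis_norm by force

text \<open>Expanding \<open>h\<close> shows that \<open>T\<close> acts diagonally on coordinates;
  the formulas for the quadratic form and the norm follow from this.\<close>

lemma cinner_basis:
  assumes "c \<in> B"
  shows "\<langle>T h, c\<rangle> = of_real (l c) * \<langle>h, c\<rangle>"
proof -
  have "T h = T (\<Sum>b\<in>B. \<langle>h, b\<rangle> *\<^sub>C b)"
    by (simp only: onb_expand[OF onb])
  also have "\<dots> = (\<Sum>b\<in>B. (\<langle>h, b\<rangle> * of_real (l b)) *\<^sub>C b)"
    unfolding clinear_sum[OF clinear] by (intro sum.cong) (simp_all add: eigen scaleC_scaleC)
  finally show ?thesis
    using orthonormal_cinner_sum[of B B c "\<lambda>b. \<langle>h, b\<rangle> * of_real (l b)"] onb assms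
    by (simp add: onb_def)
qed

lemma quadratic_form: "\<langle>T h, h\<rangle> = of_real (\<Sum>b\<in>B. l b * (cmod \<langle>h, b\<rangle>)\<^sup>2)"
proof -
  have "\<langle>T h, h\<rangle> = (\<Sum>b\<in>B. of_real (l b) * \<langle>h, b\<rangle> * cnj \<langle>h, b\<rangle>)"
    unfolding onb_cinner[OF onb, of "T h" h]
    by (intro sum.cong) (simp_all add: cinner_basis cinner_commute[of _ h])
  then show ?thesis
    by (simp add: complex_norm_square mult.assoc del: of_real_power)
qed

lemma norm_image_square: "(norm (T h))\<^sup>2 = (\<Sum>b\<in>B. (l b)\<^sup>2 * (cmod \<langle>h, b\<rangle>)\<^sup>2)"
  unfolding onb_norm_square[OF onb, of "T h"]
  by (intro sum.cong) (simp_all add: cinner_basis norm_mult power_mult_distrib)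

lemma basis_quadratic_form:
  assumes "b \<in> B"
  shows "\<langle>T b, b\<rangle> = of_real (l b)"
  using assms by (simp add: cinner_basis cinner_self basis_norm)

lemma Min_le: "b \<in> B \<Longrightarrow> Min (l ` B) \<le> l b"
  and Max_ge: "b \<in> B \<Longrightarrow> l b \<le> Max (l ` B)"
  using finite by simp_all

lemma Min_attained: obtains b where "b \<in> B" "l b = Min (l ` B)"
  using Min_in[of "l ` B"] finite nonempty that by fastforce

lemma Max_attained: obtains b where "b \<in> B" "l b = Max (l ` B)"
  using Max_in[of "l ` B"] finite nonempty that by fastforce

text \<open>The form is a sum of eigenvalues with non-negative weights whose total is the squared
  norm of \<open>h\<close>, so each eigenvalue may be replaced by the extreme one.\<close>

lemma quadratic_form_ge: "of_real (Min (l ` B) * (norm h)\<^sup>2) \<le> \<langle>T h, h\<rangle>"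
  unfolding quadratic_form onb_norm_square[OF onb, of h] sum_distrib_left
  by (auto simp: less_eq_complex_def intro!: sum_mono mult_right_mono Min_le
      simp del: of_real_sum of_real_mult of_real_power)

lemma quadratic_form_le: "\<langle>T h, h\<rangle> \<le> of_real (Max (l ` B) * (norm h)\<^sup>2)"
  unfolding quadratic_form onb_norm_square[OF onb, of h] sum_distrib_left
  by (auto simp: less_eq_complex_def intro!: sum_mono mult_right_mono Max_ge
      simp del: of_real_sum of_real_mult of_real_power)

text \<open>A non-zero \<open>v\<close> has a non-zero coordinate at some \<open>b\<close>;
  comparing that coordinate on both sides of the eigenvalue equation forces \<open>z\<close> to be
  the eigenvalue at \<open>b\<close>.\<close>

lemma op_eigenvalue_iff: "op_eigenvalue T z \<longleftrightarrow> (\<exists>b\<in>B. z = of_real (l b))"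
proof
  assume "op_eigenvalue T z"
  then obtain v where v: "v \<noteq> 0" "T v = z *\<^sub>C v" by (auto simp: op_eigenvalue_def)
  have "\<exists>b\<in>B. \<langle>v, b\<rangle> \<noteq> 0"
    using onb_expand[OF onb, of v] v(1) by - (rule ccontr, simp)
  then obtain b where b: "b \<in> B" "\<langle>v, b\<rangle> \<noteq> 0" by blast
  then have "z = of_real (l b)"
    using cinner_basis[of b v] v(2) by (simp add: cinner_scaleC_left)
  then show "\<exists>b\<in>B. z = of_real (l b)" using b(1) by blast
next
  assume "\<exists>b\<in>B. z = of_real (l b)"
  then show "op_eigenvalue T z"
    unfolding op_eigenvalue_def using eigen basis_nonzero by blast
qed

lemma smallest_eigenvalue: "smallest_eigenvalue T (Min (l ` B))"
  unfolding smallest_eigenvalue_def op_eigenvalue_iff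
proof (intro conjI allI impI)
  show "\<exists>b\<in>B. complex_of_real (Min (l ` B)) = of_real (l b)"
    using Min_attained by metis
  show "of_real (Min (l ` B)) \<le> z" if "\<exists>b\<in>B. z = complex_of_real (l b)" for z
    using that Min_le by (auto simp: less_eq_complex_def)
qed

lemma largest_eigenvalue: "largest_eigenvalue T (Max (l ` B))"
  unfolding largest_eigenvalue_def op_eigenvalue_iff
proof (intro conjI allI impI)
  show "\<exists>b\<in>B. complex_of_real (Max (l ` B)) = of_real (l b)"
    using Max_attained by metis
  show "z \<le> of_real (Max (l ` B))" if "\<exists>b\<in>B. z = complex_of_real (l b)" for z
    using that Max_ge by (auto simp: less_eq_complex_def)
qed

lemma eigenvalues: "op_eigenvalues T = image_mset (\<lambda>b. of_real (l b)) (mset_set B)"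
  by (rule op_eigenvalues_onb[OF onb clinear eigen])

lemma trace: "op_trace T = of_real (\<Sum>b\<in>B. l b)"
  by (simp add: onb_trace[OF onb clinear] basis_quadratic_form)

text \<open>Coordinatewise comparison of squares, valid because the eigenvalues are non-negative,
  gives the upper bound; an eigenvector for the largest eigenvalue attains it.\<close>

lemma onorm: "onorm T = Max (l ` B)"
proof (rule antisym)
  interpret T: Vector_Spaces.linear scaleC scaleC T by (rule clinear)
  have Max_nonneg: "0 \<le> Max (l ` B)"
    using Max_attained nonneg by metis
  have bound: "norm (T h) \<le> Max (l ` B) * norm h" for h
  proof (rule power2_le_imp_le)
    show "(norm (T h))\<^sup>2 \<le> (Max (l ` B) * norm h)\<^sup>2"
      unfolding norm_image_square power_mult_distrib onb_norm_square[OF onb, of h] sum_distrib_left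
      by (intro sum_mono mult_right_mono power_mono Max_ge nonneg) auto
  qed (simp add: Max_nonneg)
  then show "onorm T \<le> Max (l ` B)"
    by (intro onorm_bound Max_nonneg)
  have "bounded_linear T"
    using bound by (intro bounded_linear_intro[where K = "Max (l ` B)"])
      (simp_all add: T.add T.scale scaleR_scaleC mult.commute)
  moreover obtain b where b: "b \<in> B" "l b = Max (l ` B)" by (rule Max_attained)
  ultimately have "norm (T b) / norm b \<le> onorm T" by (intro le_onorm)
  then show "Max (l ` B) \<le> onorm T"
    using b Max_nonneg by (simp add: basis_norm eigen norm_scaleC)
qed

text \<open>The inverse has the same eigenvectors with reciprocal eigenvalues. It is a second
  instance of the locale, and its norm is the reciprocal of the smallest eigenvalue.\<close>

lemma condition_number:
  assumes inv: "invertible_op T"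
  shows "condition_number T = Max (l ` B) / Min (l ` B)"
proof -
  obtain R where R: "clinear R" "R \<circ> T = id" "T \<circ> R = id"
    using inv by (auto simp: invertible_op_def bounded_clinear_def)
  have inv_T: "inv_into UNIV T = R" using R(2,3) by (intro inv_unique_comp)
  interpret T: Vector_Spaces.linear scaleC scaleC T by (rule clinear)
  interpret R: Vector_Spaces.linear scaleC scaleC R by (rule R)
  have RT: "R (T b) = b" for b using R(2) by (simp add: fun_eq_iff)
  have nz: "l b \<noteq> 0" if "b \<in> B" for b
    using that eigen[OF that] RT[of b] basis_nonzero R.zero by auto
  then have pos: "0 < l b" if "b \<in> B" for b
    using nonneg[OF that] that by (simp add: less_le)
  have "R b = of_real (1 / l b) *\<^sub>C b" if "b \<in> B" for b
    using RT[of b] nz[OF that] eigen[OF that]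
    by (simp add: R.scale) (metis (no_types) complex_vector.scale_one complex_vector.scale_scale
        left_inverse of_real_eq_0_iff inverse_eq_divide)
  then interpret R: eigenbasis R B "\<lambda>b. 1 / l b"
    using R(1) onb nonempty nonneg by unfold_locales auto
  have "Max ((\<lambda>b. 1 / l b) ` B) = 1 / Min (l ` B)"
  proof (rule Max_eqI)
    obtain b where b: "b \<in> B" "l b = Min (l ` B)" by (rule Min_attained)
    then show "1 / Min (l ` B) \<in> (\<lambda>b. 1 / l b) ` B" by (auto intro!: image_eqI[of _ _ b])
    fix y assume "y \<in> (\<lambda>b. 1 / l b) ` B"
    then show "y \<le> 1 / Min (l ` B)"
      using b pos[of b] Min_le by (auto intro!: divide_left_mono mult_pos_pos pos)
  qed (use finite in simp)
  then show ?thesis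
    unfolding condition_number_def inv_T onorm R.onorm by simp
qed

end

section \<open>Weak integrals of frames\<close>

text \<open>The hypothesis supplies a weak integral, so the definite description behind
  \<open>frame_operator\<close> really denotes it.\<close>

lemma has_bochner_integral_frame_operator:
  assumes "weakly_integrable M (\<lambda>\<alpha>. \<langle>h, x \<alpha>\<rangle> *\<^sub>C \<tau> \<alpha>)"
  shows "has_bochner_integral M (\<lambda>\<alpha>. \<langle>h, x \<alpha>\<rangle> * \<langle>\<tau> \<alpha>, g\<rangle>) \<langle>frame_operator M x \<tau> h, g\<rangle>"
proof -
  obtain v where v: "has_weak_integral M (\<lambda>\<alpha>. \<langle>h, x \<alpha>\<rangle> *\<^sub>C \<tau> \<alpha>) v"
    using assms by (auto simp: weakly_integrable_def)
  then show ?thesis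
    using weak_integral_eqI[OF v]
    by (simp add: frame_operator_def has_weak_integral_def cinner_scaleC_left)
qed

text \<open>Conjugating integrand and value exchanges the roles of \<open>x\<close> and
  \<open>\<tau>\<close> and replaces \<open>U\<close> by its adjoint.\<close>

lemma has_bochner_integral_adjoint:
  assumes "has_bochner_integral M (\<lambda>\<alpha>. \<langle>g, x \<alpha>\<rangle> * \<langle>\<tau> \<alpha>, h\<rangle>) \<langle>U g, h\<rangle>"
  shows "has_bochner_integral M (\<lambda>\<alpha>. \<langle>h, \<tau> \<alpha>\<rangle> * \<langle>x \<alpha>, g\<rangle>) \<langle>h, U g\<rangle>"
  using has_bochner_integral_bounded_linear[OF bounded_linear_cnj assms]
  by (simp add: mult.commute flip: cinner_commute)

text \<open>The expansion of \<open>\<tau> \<alpha>\<close> is a finite sum, hence commutes with the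
  integral; the term at \<open>b\<close> uses \<open>form\<close> with \<open>h = T b\<close> and
  \<open>g = b\<close>. Stating the hypothesis for a general \<open>U\<close> allows
  \<open>x\<close> and \<open>\<tau>\<close> to be swapped.\<close>

lemma has_bochner_integral_trace:
  fixes x \<tau> :: "'a \<Rightarrow> 'h::complex_inner" and B :: "'h set"
  assumes B: "onb B" and T: "clinear T" and U: "clinear U"
    and form: "\<And>g h. has_bochner_integral M (\<lambda>\<alpha>. \<langle>h, x \<alpha>\<rangle> * \<langle>\<tau> \<alpha>, g\<rangle>) \<langle>U h, g\<rangle>"
  shows "has_bochner_integral M (\<lambda>\<alpha>. \<langle>T (\<tau> \<alpha>), x \<alpha>\<rangle>) (op_trace (U \<circ> T))"
proof -
  have "\<langle>T (\<tau> \<alpha>), x \<alpha>\<rangle> = (\<Sum>b\<in>B. \<langle>T b, x \<alpha>\<rangle> * \<langle>\<tau> \<alpha>, b\<rangle>)" for \<alpha>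
  proof -
    have "\<langle>T (\<tau> \<alpha>), x \<alpha>\<rangle> = \<langle>T (\<Sum>b\<in>B. \<langle>\<tau> \<alpha>, b\<rangle> *\<^sub>C b), x \<alpha>\<rangle>"
      by (simp only: onb_expand[OF B])
    then show ?thesis
      by (simp add: clinear_sum[OF T] cinner_sum_left cinner_scaleC_left mult.commute)
  qed
  moreover have "op_trace (U \<circ> T) = (\<Sum>b\<in>B. \<langle>U (T b), b\<rangle>)"
    using onb_trace[OF B] Vector_Spaces.linear_compose[OF T U] by simp
  ultimately show ?thesis
    using form by (simp add: has_bochner_integral_sum)
qed

text \<open>Positive eigenvalues make the minimum an admissible bound; testing any other bound on an
  eigenvector for the smallest eigenvalue shows that it is no larger.\<close>

lemma optimal_lower_frame_bound_iff:
  assumes "eigenbasis (frame_operator M x \<tau>) B l" and pos: "\<And>b. b \<in> B \<Longrightarrow> 0 < l b"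
  shows "optimal_lower_frame_bound M x \<tau> a \<longleftrightarrow> a = Min (l ` B)"
proof -
  interpret eigenbasis "frame_operator M x \<tau>" B l by fact
  have "lower_frame_bound M x \<tau> (Min (l ` B))"
    unfolding lower_frame_bound_def using quadratic_form_ge Min_attained pos by metis
  moreover have "a' \<le> Min (l ` B)" if "lower_frame_bound M x \<tau> a'" for a'
  proof -
    obtain b where b: "b \<in> B" "l b = Min (l ` B)" by (rule Min_attained)
    have "of_real (a' * (norm b)\<^sup>2) \<le> \<langle>frame_operator M x \<tau> b, b\<rangle>"
      using that unfolding lower_frame_bound_def by blast
    then show ?thesis using b by (simp add: basis_norm basis_quadratic_form less_eq_complex_def)
  qed
  ultimately show ?thesis
    unfolding optimal_lower_frame_bound_def by (auto intro: antisym)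
qed

lemma optimal_upper_frame_bound_iff:
  assumes "eigenbasis (frame_operator M x \<tau>) B l" and pos: "\<And>b. b \<in> B \<Longrightarrow> 0 < l b"
  shows "optimal_upper_frame_bound M x \<tau> c \<longleftrightarrow> c = Max (l ` B)"
proof -
  interpret eigenbasis "frame_operator M x \<tau>" B l by fact
  have "upper_frame_bound M x \<tau> (Max (l ` B))"
    unfolding upper_frame_bound_def using quadratic_form_le Max_attained pos by metis
  moreover have "Max (l ` B) \<le> c'" if "upper_frame_bound M x \<tau> c'" for c'
  proof -
    obtain b where b: "b \<in> B" "l b = Max (l ` B)" by (rule Max_attained)
    have "\<langle>frame_operator M x \<tau> b, b\<rangle> \<le> of_real (c' * (norm b)\<^sup>2)"
      using that unfolding upper_frame_bound_def by blast
    then show ?thesis using b by (simp add: basis_norm basis_quadratic_form less_eq_complex_def)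
  qed
  ultimately show ?thesis
    unfolding optimal_upper_frame_bound_def by (auto intro: antisym)
qed

text \<open>Positivity makes the eigenvalues non-negative, and injectivity of the frame operator
  excludes 0. The dimension hypothesis makes the basis non-empty.\<close>

lemma continuous_frame_eigenbasis:
  fixes x \<tau> :: "'a \<Rightarrow> 'h::complex_inner"
  assumes frame: "continuous_frame M x \<tau>"
    and fin: "finite A" "complex_vector.span A = (UNIV :: 'h set)"
    and dim: "complex_vector.dim (UNIV :: 'h set) \<ge> 1"
  obtains B l where "eigenbasis (frame_operator M x \<tau>) B l" "\<And>b. b \<in> B \<Longrightarrow> 0 < l b"
proof -
  let ?S = "frame_operator M x \<tau>"
  have S: "clinear ?S" "positive_op ?S" "invertible_op ?S"
    using frame by (auto simp: continuous_frame_def bounded_clinear_def)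
  obtain B l where B: "onb B" and eigen: "\<And>b. b \<in> B \<Longrightarrow> ?S b = of_real (l b) *\<^sub>C b"
    using selfadjoint_eigenbasis[OF S(1) positive_op_selfadjoint[OF S(1,2)] fin] by blast
  interpret S: Vector_Spaces.linear scaleC scaleC ?S by (rule S)
  have pos: "0 < l b" if b: "b \<in> B" for b
  proof -
    have unit: "\<langle>b, b\<rangle> = 1" using B b by (simp add: onb_def orthonormal_def)
    have "0 \<le> \<langle>?S b, b\<rangle>" using S(2) by (simp add: positive_op_def)
    then have "0 \<le> l b" by (simp add: eigen[OF b] cinner_scaleC_left unit less_eq_complex_def)
    moreover have "l b \<noteq> 0"
    proof
      assume "l b = 0"
      then have "?S b = ?S 0" using eigen[OF b] by (simp add: S.zero)
      then have "b = 0" using S(3) unfolding invertible_op_def by (metis comp_apply id_apply)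
      then show False using unit by simp
    qed
    ultimately show ?thesis by simp
  qed
  moreover have "eigenbasis ?S B l"
    using S(1) B eigen pos onb_card[OF B] dim by unfold_locales (auto simp: less_imp_le)
  ultimately show thesis using that by blast
qed

section \<open>Frames in finite dimension\<close>

theorem theorem7p3:
  fixes M :: "'a measure"
    and x \<tau> :: "'a \<Rightarrow> 'h::chilbert_space"
    and S :: "'h \<Rightarrow> 'h"
    and m :: nat
  assumes finite_dim: "\<exists>B :: 'h set. finite B \<and> complex_vector.span B = UNIV"
    and dim: "complex_vector.dim (UNIV :: 'h set) = m"
    and nonzero: "m \<ge> 1"
    and frame: "continuous_frame M x \<tau>"
    and S: "S = frame_operator M x \<tau>"
  shows
    "\<comment> \<open>existence of the integrals below\<close>
     (integrable M (\<lambda>\<alpha>. \<langle>x \<alpha>, \<tau> \<alpha>\<rangle>) \<and>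
      integrable M (\<lambda>\<alpha>. \<langle>\<tau> \<alpha>, x \<alpha>\<rangle>) \<and>
      (\<forall>\<alpha>\<in>space M. integrable M (\<lambda>\<beta>. \<langle>\<tau> \<alpha>, x \<beta>\<rangle> * \<langle>\<tau> \<beta>, x \<alpha>\<rangle>)) \<and>
      integrable M (\<lambda>\<alpha>. \<integral>\<beta>. \<langle>\<tau> \<alpha>, x \<beta>\<rangle> * \<langle>\<tau> \<beta>, x \<alpha>\<rangle> \<partial>M) \<and>
      (\<forall>\<alpha>\<in>space M. integrable M (\<lambda>\<beta>. \<langle>\<tau> \<alpha>, \<tau> \<beta>\<rangle> * \<langle>x \<beta>, x \<alpha>\<rangle>)) \<and>
      integrable M (\<lambda>\<alpha>. \<integral>\<beta>. \<langle>\<tau> \<alpha>, \<tau> \<beta>\<rangle> * \<langle>x \<beta>, x \<alpha>\<rangle> \<partial>M)) \<and>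
     \<comment> \<open>(i)\<close>
     (\<exists>a. optimal_lower_frame_bound M x \<tau> a \<and> smallest_eigenvalue S a) \<and>
     (\<exists>b. optimal_upper_frame_bound M x \<tau> b \<and> largest_eigenvalue S b) \<and>
     \<comment> \<open>(ii)\<close>
     (\<exists>ev :: nat \<Rightarrow> complex. image_mset ev (mset_set {1..m}) = op_eigenvalues S) \<and>
     (\<forall>ev :: nat \<Rightarrow> complex. image_mset ev (mset_set {1..m}) = op_eigenvalues S \<longrightarrow>
        (\<Sum>j = 1..m. ev j) = (\<integral>\<alpha>. \<langle>x \<alpha>, \<tau> \<alpha>\<rangle> \<partial>M) \<and>
        (\<integral>\<alpha>. \<langle>x \<alpha>, \<tau> \<alpha>\<rangle> \<partial>M) = (\<integral>\<alpha>. \<langle>\<tau> \<alpha>, x \<alpha>\<rangle> \<partial>M)) \<and>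
     \<comment> \<open>(iii)\<close>
     (\<forall>a b. optimal_lower_frame_bound M x \<tau> a \<longrightarrow> optimal_upper_frame_bound M x \<tau> b \<longrightarrow>
        condition_number S = b / a) \<and>
     \<comment> \<open>(iv)\<close>
     (\<forall>b. optimal_upper_frame_bound M x \<tau> b \<longrightarrow>
        of_real b \<le> (\<integral>\<alpha>. \<langle>x \<alpha>, \<tau> \<alpha>\<rangle> \<partial>M) \<and>
        (\<integral>\<alpha>. \<langle>x \<alpha>, \<tau> \<alpha>\<rangle> \<partial>M) = (\<integral>\<alpha>. \<langle>\<tau> \<alpha>, x \<alpha>\<rangle> \<partial>M) \<and>
        (\<integral>\<alpha>. \<langle>\<tau> \<alpha>, x \<alpha>\<rangle> \<partial>M) \<le> of_real (real m * b)) \<and>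
     \<comment> \<open>(v)\<close>
     (op_trace S = (\<integral>\<alpha>. \<langle>x \<alpha>, \<tau> \<alpha>\<rangle> \<partial>M) \<and>
      (\<integral>\<alpha>. \<langle>x \<alpha>, \<tau> \<alpha>\<rangle> \<partial>M) = (\<integral>\<alpha>. \<langle>\<tau> \<alpha>, x \<alpha>\<rangle> \<partial>M) \<and>
      op_trace (S \<circ> S) = (\<integral>\<alpha>. (\<integral>\<beta>. \<langle>\<tau> \<alpha>, x \<beta>\<rangle> * \<langle>\<tau> \<beta>, x \<alpha>\<rangle> \<partial>M) \<partial>M) \<and>
      (\<integral>\<alpha>. (\<integral>\<beta>. \<langle>\<tau> \<alpha>, x \<beta>\<rangle> * \<langle>\<tau> \<beta>, x \<alpha>\<rangle> \<partial>M) \<partial>M)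
        = (\<integral>\<alpha>. (\<integral>\<beta>. \<langle>\<tau> \<alpha>, \<tau> \<beta>\<rangle> * \<langle>x \<beta>, x \<alpha>\<rangle> \<partial>M) \<partial>M)) \<and>
     \<comment> \<open>(vi)\<close>
     (\<forall>b. tight_frame M x \<tau> b \<longrightarrow>
        optimal_lower_frame_bound M x \<tau> b \<and> optimal_upper_frame_bound M x \<tau> b \<and>
        of_real b = 1 / of_nat m * (\<integral>\<alpha>. \<langle>x \<alpha>, \<tau> \<alpha>\<rangle> \<partial>M) \<and>
        of_real b = 1 / of_nat m * (\<integral>\<alpha>. \<langle>\<tau> \<alpha>, x \<alpha>\<rangle> \<partial>M) \<and>
        ((\<forall>\<alpha>\<in>space M. \<langle>x \<alpha>, \<tau> \<alpha>\<rangle> = 1) \<longrightarrow>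
           ennreal b = emeasure M (space M) / of_nat m) \<and>
        (\<forall>h.
           weakly_integrable M (\<lambda>\<alpha>. \<langle>h, x \<alpha>\<rangle> *\<^sub>C \<tau> \<alpha>) \<and>
           h = of_real (1 / b) *\<^sub>C weak_integral M (\<lambda>\<alpha>. \<langle>h, x \<alpha>\<rangle> *\<^sub>C \<tau> \<alpha>) \<and>
           weakly_integrable M (\<lambda>\<alpha>. \<langle>h, \<tau> \<alpha>\<rangle> *\<^sub>C x \<alpha>) \<and>
           h = of_real (1 / b) *\<^sub>C weak_integral M (\<lambda>\<alpha>. \<langle>h, \<tau> \<alpha>\<rangle> *\<^sub>C x \<alpha>) \<and>
           integrable M (\<lambda>\<alpha>. \<langle>h, x \<alpha>\<rangle> * \<langle>\<tau> \<alpha>, h\<rangle>) \<and>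
           of_real ((norm h)\<^sup>2) = of_real (1 / b) * (\<integral>\<alpha>. \<langle>h, x \<alpha>\<rangle> * \<langle>\<tau> \<alpha>, h\<rangle> \<partial>M) \<and>
           integrable M (\<lambda>\<alpha>. \<langle>h, \<tau> \<alpha>\<rangle> * \<langle>x \<alpha>, h\<rangle>) \<and>
           of_real ((norm h)\<^sup>2) = of_real (1 / b) * (\<integral>\<alpha>. \<langle>h, \<tau> \<alpha>\<rangle> * \<langle>x \<alpha>, h\<rangle> \<partial>M))) \<and>
     \<comment> \<open>(vii)\<close>
     ((\<exists>b. tight_frame M x \<tau> b) \<longrightarrow>
        (\<integral>\<alpha>. (\<integral>\<beta>. \<langle>\<tau> \<alpha>, x \<beta>\<rangle> * \<langle>\<tau> \<beta>, x \<alpha>\<rangle> \<partial>M) \<partial>M)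
          = 1 / of_nat m * (\<integral>\<alpha>. \<langle>x \<alpha>, \<tau> \<alpha>\<rangle> \<partial>M)\<^sup>2 \<and>
        1 / of_nat m * (\<integral>\<alpha>. \<langle>x \<alpha>, \<tau> \<alpha>\<rangle> \<partial>M)\<^sup>2
          = 1 / of_nat m * (\<integral>\<alpha>. \<langle>\<tau> \<alpha>, x \<alpha>\<rangle> \<partial>M)\<^sup>2 \<and>
        1 / of_nat m * (\<integral>\<alpha>. \<langle>\<tau> \<alpha>, x \<alpha>\<rangle> \<partial>M)\<^sup>2
          = (\<integral>\<alpha>. (\<integral>\<beta>. \<langle>\<tau> \<alpha>, \<tau> \<beta>\<rangle> * \<langle>x \<beta>, x \<alpha>\<rangle> \<partial>M) \<partial>M)) \<and>
     \<comment> \<open>(viii)\<close>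
     (parseval_frame M x \<tau> \<longrightarrow>
        of_nat m = (\<integral>\<alpha>. \<langle>x \<alpha>, \<tau> \<alpha>\<rangle> \<partial>M) \<and>
        (\<integral>\<alpha>. \<langle>x \<alpha>, \<tau> \<alpha>\<rangle> \<partial>M) = (\<integral>\<alpha>. \<langle>\<tau> \<alpha>, x \<alpha>\<rangle> \<partial>M)) \<and>
     \<comment> \<open>(ix)\<close>
     (parseval_frame M x \<tau> \<longrightarrow> (\<forall>T. bounded_clinear T \<longrightarrow>
        integrable M (\<lambda>\<alpha>. \<langle>T (x \<alpha>), \<tau> \<alpha>\<rangle>) \<and>
        op_trace T = (\<integral>\<alpha>. \<langle>T (x \<alpha>), \<tau> \<alpha>\<rangle> \<partial>M) \<and>
        integrable M (\<lambda>\<alpha>. \<langle>T (\<tau> \<alpha>), x \<alpha>\<rangle>) \<and>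
        op_trace T = (\<integral>\<alpha>. \<langle>T (\<tau> \<alpha>), x \<alpha>\<rangle> \<partial>M)))"
proof -
  obtain A :: "'h set" where A: "finite A" "complex_vector.span A = UNIV"
    using finite_dim by blast
  obtain B l where "eigenbasis S B l" and pos: "\<And>b. b \<in> B \<Longrightarrow> 0 < l b"
    using continuous_frame_eigenbasis[OF frame A] dim nonzero unfolding S by metis
  then interpret eigenbasis S B l by blast
  have card: "card B = m" using onb_card[OF onb] dim by simp
  have wi: "weakly_integrable M (\<lambda>\<alpha>. \<langle>h, x \<alpha>\<rangle> *\<^sub>C \<tau> \<alpha>)"
    and pos_S: "positive_op S" and inv: "invertible_op S" for h
    using frame by (auto simp: continuous_frame_def S)
  have form: "has_bochner_integral M (\<lambda>\<alpha>. \<langle>h, x \<alpha>\<rangle> * \<langle>\<tau> \<alpha>, g\<rangle>) \<langle>S h, g\<rangle>" for g h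
    unfolding S by (rule has_bochner_integral_frame_operator[OF wi])
  \<comment> \<open>As \<open>S\<close> is self-adjoint, the swapped pair has the same frame
    operator.\<close>
  have form': "has_bochner_integral M (\<lambda>\<alpha>. \<langle>h, \<tau> \<alpha>\<rangle> * \<langle>x \<alpha>, g\<rangle>) \<langle>S h, g\<rangle>" for g h
    unfolding positive_op_selfadjoint[OF clinear pos_S]
    by (rule has_bochner_integral_adjoint[where U = S, OF form])
  have weak: "has_weak_integral M (\<lambda>\<alpha>. \<langle>h, x \<alpha>\<rangle> *\<^sub>C \<tau> \<alpha>) (S h)"
    "has_weak_integral M (\<lambda>\<alpha>. \<langle>h, \<tau> \<alpha>\<rangle> *\<^sub>C x \<alpha>) (S h)" for h
    by (simp_all add: has_weak_integral_def cinner_scaleC_left form form')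
  have tr: "has_bochner_integral M (\<lambda>\<alpha>. \<langle>T (\<tau> \<alpha>), x \<alpha>\<rangle>) (op_trace (S \<circ> T))"
    "has_bochner_integral M (\<lambda>\<alpha>. \<langle>T (x \<alpha>), \<tau> \<alpha>\<rangle>) (op_trace (S \<circ> T))" if "clinear T" for T
    using that by (auto intro!: has_bochner_integral_trace[OF onb] clinear form form')
  \<comment> \<open>The identity yields the trace of \<open>S\<close>; \<open>T = S\<close> below
    yields that of its square.\<close>
  note tr_id = tr[OF complex_vector.linear_id, simplified]
  note tr_S = tr(1)[OF clinear]
  have ints: "integrable M (\<lambda>\<alpha>. \<langle>x \<alpha>, \<tau> \<alpha>\<rangle>)" "integrable M (\<lambda>\<alpha>. \<langle>\<tau> \<alpha>, x \<alpha>\<rangle>)"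
    and int_eq: "(\<integral>\<alpha>. \<langle>x \<alpha>, \<tau> \<alpha>\<rangle> \<partial>M) = op_trace S" "(\<integral>\<alpha>. \<langle>\<tau> \<alpha>, x \<alpha>\<rangle> \<partial>M) = op_trace S"
    using tr_id by (auto simp: has_bochner_integral_iff)
  \<comment> \<open>With \<open>h = \<tau> \<alpha>\<close> and \<open>g = x \<alpha>\<close> both
    inner integrals become \<open>\<langle>S (\<tau> \<alpha>), x \<alpha>\<rangle>\<close>, so the
    two double integrals agree already before the outer integration.\<close>
  have forms: "integrable M (\<lambda>\<alpha>. \<langle>h, x \<alpha>\<rangle> * \<langle>\<tau> \<alpha>, g\<rangle>)" "integrable M (\<lambda>\<alpha>. \<langle>h, \<tau> \<alpha>\<rangle> * \<langle>x \<alpha>, g\<rangle>)"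
    and forms_eq: "(\<integral>\<alpha>. \<langle>h, x \<alpha>\<rangle> * \<langle>\<tau> \<alpha>, g\<rangle> \<partial>M) = \<langle>S h, g\<rangle>"
    "(\<integral>\<alpha>. \<langle>h, \<tau> \<alpha>\<rangle> * \<langle>x \<alpha>, g\<rangle> \<partial>M) = \<langle>S h, g\<rangle>" for g h
    using form form' by (simp_all add: has_bochner_integral_iff)
  have double: "(\<integral>\<alpha>. \<langle>S (\<tau> \<alpha>), x \<alpha>\<rangle> \<partial>M) = op_trace (S \<circ> S)"
    "integrable M (\<lambda>\<alpha>. \<langle>S (\<tau> \<alpha>), x \<alpha>\<rangle>)"
    using tr_S by (simp_all add: has_bochner_integral_iff)
  note lower = optimal_lower_frame_bound_iff[OF eigenbasis_axioms[unfolded S] pos]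
    and upper = optimal_upper_frame_bound_iff[OF eigenbasis_axioms[unfolded S] pos]
  have trace_ge: "Max (l ` B) \<le> (\<Sum>b\<in>B. l b)"
    using Max_attained member_le_sum[of _ B l] nonneg finite by (metis DiffD1)
  have trace_le: "(\<Sum>b\<in>B. l b) \<le> real m * Max (l ` B)"
    using sum_bounded_above[of B l "Max (l ` B)"] Max_ge card by simp
  have tight: "l ` B = {b}" "op_trace S = of_nat m * of_real b"
      "op_trace (S \<circ> S) = of_nat m * (of_real b)\<^sup>2" if "tight_frame M x \<tau> b" for b
  proof -
    have Sb: "S = (\<lambda>h. of_real b *\<^sub>C h)" using that by (simp add: tight_frame_def S)
    have "l c = b" if "c \<in> B" for c
      using basis_quadratic_form[OF that]
      by (simp add: Sb cinner_scaleC_left cinner_self basis_norm that)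
    then show "l ` B = {b}" and "op_trace S = of_nat m * of_real b"
      using nonempty by (auto simp: trace card)
    have "op_trace (S \<circ> S) = (\<Sum>c\<in>B. \<langle>S (S c), c\<rangle>)"
      using onb_trace[OF onb Vector_Spaces.linear_compose[OF clinear clinear]] by simp
    then show "op_trace (S \<circ> S) = of_nat m * (of_real b)\<^sup>2"
      by (simp add: Sb cinner_scaleC_left cinner_self basis_norm card power2_eq_square)
  qed
  have m0: "(of_nat m :: complex) \<noteq> 0" using nonzero by simp
  have ev_ex: "\<exists>ev :: nat \<Rightarrow> complex. image_mset ev (mset_set {1..m}) = op_eigenvalues S"
  proof -
    obtain f where f: "bij_betw f {1..m} B"
      using ex_bij_betw_nat_finite_1[OF finite] card by blast
    then have "mset_set B = image_mset f (mset_set {1..m})"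
      by (metis bij_betw_def image_mset_mset_set)
    then have "image_mset (\<lambda>i. complex_of_real (l (f i))) (mset_set {1..m}) = op_eigenvalues S"
      by (simp add: eigenvalues image_mset.compositionality comp_def)
    then show ?thesis by blast
  qed
  have ev_sum: "(\<Sum>j = 1..m. ev j) = op_trace S"
    if "image_mset ev (mset_set {1..m}) = op_eigenvalues S" for ev :: "nat \<Rightarrow> complex"
  proof -
    \<comment> \<open>The sum depends only on the multiset of values, so every enumeration of the
      eigenvalues is covered.\<close>
    have "(\<Sum>j = 1..m. ev j) = \<Sum>\<^sub># (op_eigenvalues S)"
      unfolding that[symmetric] by (simp add: sum_unfold_sum_mset)
    then show ?thesis by (simp add: eigenvalues trace sum_unfold_sum_mset[of _ B]
          image_mset.compositionality comp_def)
  qed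
  have tight_opt: "optimal_lower_frame_bound M x \<tau> b \<and> optimal_upper_frame_bound M x \<tau> b"
    if "tight_frame M x \<tau> b" for b
    using tight[OF that] by (simp add: lower upper)
  have tight_measure: "ennreal b = emeasure M (space M) / of_nat m"
    if b: "tight_frame M x \<tau> b" and one: "\<forall>\<alpha>\<in>space M. \<langle>x \<alpha>, \<tau> \<alpha>\<rangle> = 1" for b
  proof -
    have "integrable M (\<lambda>\<alpha>. 1 :: complex)"
      using ints(1) one Bochner_Integration.integrable_cong[of M M "\<lambda>\<alpha>. \<langle>x \<alpha>, \<tau> \<alpha>\<rangle>" "\<lambda>\<alpha>. 1"]
      by simp
    moreover have "(\<integral>\<alpha>. 1 \<partial>M) = op_trace S"
      using int_eq(1) one
        Bochner_Integration.integral_cong[of M M "\<lambda>\<alpha>. \<langle>x \<alpha>, \<tau> \<alpha>\<rangle>" "\<lambda>\<alpha>. 1"]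
      by simp
    \<comment> \<open>Integrability of the constant 1 forces finite total measure. This excludes the
      case where \<open>measure\<close> defaults to 0 and allows the return to
      \<open>emeasure\<close>.\<close>
    ultimately have fin: "emeasure M (space M) \<noteq> \<infinity>" and "of_real (measure M (space M)) = op_trace S"
      by (auto simp: integrable_iff_bounded scaleR_conv_of_real)
    then have "complex_of_real (measure M (space M)) = of_real (real m * b)"
      using tight(2)[OF b] by simp
    then have "measure M (space M) = real m * b" by (simp only: of_real_eq_iff)
    then have "emeasure M (space M) = ennreal (real m * b)"
      using fin by (simp add: emeasure_eq_ennreal_measure)
    moreover have "0 < b" using b by (simp add: tight_frame_def)
    ultimately have "emeasure M (space M) / of_nat m = ennreal (real m * b / real m)"
      using nonzero divide_ennreal[of "real m * b" "real m"]
      by (simp add: ennreal_of_nat_eq_real_of_nat)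
    then show ?thesis using nonzero by simp
  qed
  have tight_expand: "h = of_real (1 / b) *\<^sub>C S h"
    "of_real ((norm h)\<^sup>2) = of_real (1 / b) * \<langle>S h, h\<rangle>" if "tight_frame M x \<tau> b" for b h
    using that by (auto simp: tight_frame_def S[symmetric] scaleC_scaleC scaleC_one
        cinner_scaleC_left cinner_self simp flip: of_real_mult)
  have parseval_trace: "op_trace T = op_trace (S \<circ> T)" if "parseval_frame M x \<tau>" for T
    using that by (simp add: parseval_frame_def S)
  have parseval_dim: "of_nat m = op_trace S" if "parseval_frame M x \<tau>"
  proof -
    have "tight_frame M x \<tau> 1"
      using that by (auto simp: parseval_frame_def tight_frame_def scaleC_one)
    from tight(2)[OF this] show ?thesis by simp
  qed
  have bounds: "\<exists>a. optimal_lower_frame_bound M x \<tau> a \<and> smallest_eigenvalue S a"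
    "\<exists>b. optimal_upper_frame_bound M x \<tau> b \<and> largest_eigenvalue S b"
    by (simp_all add: lower upper smallest_eigenvalue largest_eigenvalue)
  have cond: "condition_number S = b / a"
    if "optimal_lower_frame_bound M x \<tau> a" "optimal_upper_frame_bound M x \<tau> b" for a b
    using that condition_number[OF inv] by (simp add: lower upper)
  have upper_trace: "of_real b \<le> op_trace S" "op_trace S \<le> of_real (real m * b)"
    if "optimal_upper_frame_bound M x \<tau> b" for b
    using that trace_ge trace_le by (simp_all add: upper trace less_eq_complex_def)
  have weakly: "weakly_integrable M (\<lambda>\<alpha>. \<langle>h, x \<alpha>\<rangle> *\<^sub>C \<tau> \<alpha>)"
    "weakly_integrable M (\<lambda>\<alpha>. \<langle>h, \<tau> \<alpha>\<rangle> *\<^sub>C x \<alpha>)"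
    and weak_eq: "weak_integral M (\<lambda>\<alpha>. \<langle>h, x \<alpha>\<rangle> *\<^sub>C \<tau> \<alpha>) = S h" "weak_integral M (\<lambda>\<alpha>. \<langle>h, \<tau> \<alpha>\<rangle> *\<^sub>C x \<alpha>) = S h" for h
    using weak by (auto simp: weakly_integrable_def intro: weak_integral_eqI)
  have tight_trace: "of_real b = 1 / of_nat m * op_trace S"
    "op_trace (S \<circ> S) = 1 / of_nat m * (op_trace S)\<^sup>2" if "tight_frame M x \<tau> b" for b
    using tight[OF that] m0 by (simp_all add: power2_eq_square field_simps)
  have T_trace: "integrable M (\<lambda>\<alpha>. \<langle>T (x \<alpha>), \<tau> \<alpha>\<rangle>)" "(\<integral>\<alpha>. \<langle>T (x \<alpha>), \<tau> \<alpha>\<rangle> \<partial>M) = op_trace (S \<circ> T)"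
    "integrable M (\<lambda>\<alpha>. \<langle>T (\<tau> \<alpha>), x \<alpha>\<rangle>)" "(\<integral>\<alpha>. \<langle>T (\<tau> \<alpha>), x \<alpha>\<rangle> \<partial>M) = op_trace (S \<circ> T)"
    if "bounded_clinear T" for T
    using that tr[of T] by (simp_all add: bounded_clinear_def has_bochner_integral_iff)
  have T_trace_eq: "op_trace T = (\<integral>\<alpha>. \<langle>T (x \<alpha>), \<tau> \<alpha>\<rangle> \<partial>M)"
    "op_trace T = (\<integral>\<alpha>. \<langle>T (\<tau> \<alpha>), x \<alpha>\<rangle> \<partial>M)"
    if "parseval_frame M x \<tau>" "bounded_clinear T" for T
    using T_trace[OF that(2)] parseval_trace[OF that(1), of T] by simp_all
  show ?thesis
    \<comment> \<open>This expresses the integrals through \<open>S\<close> and traces, which turns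
      the conjuncts into the facts collected above.\<close>
    unfolding forms_eq weak_eq double(1) int_eq
    by (intro conjI allI impI ballI)
      (blast intro: refl ints double(2) forms bounds ev_ex ev_sum cond upper_trace
        tight_opt[THEN conjunct1] tight_opt[THEN conjunct2] tight_trace tight_trace(2)[symmetric]
        tight_measure tight_expand weakly parseval_dim T_trace T_trace_eq)+
qed

end
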